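(* Let $X$ be a locally finite poset and $K$ a field. Let $\sigma\in I(X,K)$ be multiplicative, let $\lambda\in\mathrm{Aut}(X)$, and let $\psi=M_\sigma\circ\hat\lambda\in\mathrm{Aut}(I(X,K))$. Then $$\mathrm{PDer}^{\psi}(I(X,K))=\mathrm{IDer}^{\psi}(I(X,K))\cap\mathrm{ADer}^{\psi}(I(X,K)).$$
   Context: A poset is locally finite if all its intervals $\{z: x\le z\le y\}$ are finite. $\mathrm{Aut}(X)$ is the group of bijections $\lambda:X\to X$ with $x\le y\iff\lambda(x)\le\lambda(y)$. The incidence algebra $I(X,K)$ is the $K$-space of functions $f:X\times X\to K$ with $f(x,y)=0$ for $x\nleq y$, with product $(fg)(x,y)=\sum_{x\le z\le y}f(x,z)g(z,y)$; it is associative and unital. An element $\sigma\in I(X,K)$ is multiplicative if $\sigma(x,y)\ne 0$ for all $x\le y$ and $\sigma(x,z)=\sigma(x,y)\sigma(y,z)$ whenever $x\le y\le z$; it determines the automorphism $M_\sigma$ of $I(X,K)$, $M_\sigma(f)(x,y)=\sigma(x,y)f(x,y)$. Each $\lambda\in\mathrm{Aut}(X)$ induces the automorphism $\hat\lambda$ of $I(X,K)$, $\hat\lambda(f)(x,y)=f(\lambda^{-1}(x),\lambda^{-1}(y))$. For a $K$-algebra $A$ and $\psi\in\mathrm{Aut}(A)$, a $\psi$-derivation of $A$ is a linear map $d:A\to A$ with $d(ab)=d(a)b+\psi(a)d(b)$ for all $a,b\in A$; $\mathrm{Der}^{\psi}(A)$ is the $K$-space of all of them. If $A$ is associative, then for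 $a\in A$ the map $D^\psi_a(b)=ab-\psi(b)a$ is an inner $\psi$-derivation; $\mathrm{IDer}^{\psi}(A)$ is the subspace of all inner $\psi$-derivations. An element $\tau\in I(X,K)$ is $(\sigma,\lambda)$-additive if $\tau(x,y)=0$ whenever $\lambda(x)\nleq y$, and $\tau(x,z)=\tau(x,y)+\sigma(\lambda(x),\lambda(y))\tau(y,z)$ for all $x\le y\le z$. For such $\tau$, the map $L_\tau:I(X,K)\to I(X,K)$ is defined by $L_\tau(f)(\lambda(x),y)=\tau(x,y)f(x,y)$ for all $f\in I(X,K)$, $x,y\in X$. A $\psi$-derivation $d$ (with $\psi=M_\sigma\circ\hat\lambda$) is additive if $d=L_\tau$ for some $(\sigma,\lambda)$-additive $\tau$; $\mathrm{ADer}^{\psi}(I(X,K))$ is the set of all additive $\psi$-derivations. For $\epsilon:X\to K$ with $\epsilon(x)=0$ whenever $\lambda(x)\nleq x$, define $\tau_\epsilon\in I(X,K)$ by $\tau_\epsilon(x,y)=\epsilon(x)-\sigma(\lambda(x),\lambda(y))\epsilon(y)$ for all $x\le y$. An element $\tau\in I(X,K)$ is $(\sigma,\lambda)$-potential if $\tau=\tau_\epsilon$ for some such $\epsilon$ (such $\tau$ is $(\sigma,\lambda)$-additive). An additive $\psi$-derivation $L_\tau$ with $\tau$ $(\sigma,\lambda)$-potential is called potential; $\mathrm{PDer}^{\psi}(I(X,K))$ is the subspace of all potential $\psi$-derivations. *)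

theory Defs
  imports Complex_Main
begin

section \<open>Incidence algebras of locally finite posets\<close>

class locally_finite_order = order +
  assumes finite_interval: "finite {z. x \<le> z \<and> z \<le> y}"

typedef (overloaded) ('a::order, 'k::zero) incidence_alg =
    "{f :: 'a \<Rightarrow> 'a \<Rightarrow> 'k. \<forall>x y. \<not> x \<le> y \<longrightarrow> f x y = 0}"
  morphisms coeff Abs_incidence_alg
  by (rule exI[of _ "\<lambda>_ _. 0"]) simp

setup_lifting type_definition_incidence_alg

lemma coeff_eq_0: "\<not> x \<le> y \<Longrightarrow> coeff f x y = 0"
  using coeff[of f] by simp

lemma incidence_eqI: "(\<And>x y. x \<le> y \<Longrightarrow> coeff f x y = coeff g x y) \<Longrightarrow> f = g"
  by (metis coeff_eq_0 coeff_inject ext)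

text \<open>
  The element of the incidence algebra with prescribed values on the pairs \<open>x \<le> y\<close>;
  values of the given function at other pairs are discarded.
\<close>
lift_definition incidence :: "('a::order \<Rightarrow> 'a \<Rightarrow> 'k::zero) \<Rightarrow> ('a, 'k) incidence_alg"
  is "\<lambda>f x y. if x \<le> y then f x y else 0" by simp

lemma coeff_incidence: "coeff (incidence f) x y = (if x \<le> y then f x y else 0)"
  by transfer simp

instantiation incidence_alg :: (order, ab_group_add) ab_group_add
begin

lift_definition zero_incidence_alg :: "('a, 'b) incidence_alg" is "\<lambda>_ _. 0" by simp

lift_definition plus_incidence_alg ::
    "('a, 'b) incidence_alg \<Rightarrow> ('a, 'b) incidence_alg \<Rightarrow> ('a, 'b) incidence_alg"
  is "\<lambda>f g x y. f x y + g x y" by simp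

lift_definition uminus_incidence_alg :: "('a, 'b) incidence_alg \<Rightarrow> ('a, 'b) incidence_alg"
  is "\<lambda>f x y. - f x y" by simp

lift_definition minus_incidence_alg ::
    "('a, 'b) incidence_alg \<Rightarrow> ('a, 'b) incidence_alg \<Rightarrow> ('a, 'b) incidence_alg"
  is "\<lambda>f g x y. f x y - g x y" by simp

instance
  by standard (transfer; auto simp: algebra_simps fun_eq_iff)+

end

lemma coeff_zero: "coeff 0 x y = 0"
  by transfer simp
lemma coeff_plus: "coeff (f + g) x y = coeff f x y + coeff g x y"
  by transfer simp
lemma coeff_uminus: "coeff (- f) x y = - coeff f x y"
  by transfer simp
lemma coeff_minus: "coeff (f - g) x y = coeff f x y - coeff g x y"
  by transfer simp

instantiation incidence_alg :: (locally_finite_order, ring_1) ring_1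
begin

definition one_incidence_alg :: "('a, 'b) incidence_alg" where
  "1 = incidence (\<lambda>x y. if x = y then 1 else 0)"

definition times_incidence_alg ::
    "('a, 'b) incidence_alg \<Rightarrow> ('a, 'b) incidence_alg \<Rightarrow> ('a, 'b) incidence_alg" where
  "f * g = incidence (\<lambda>x y. \<Sum>z | x \<le> z \<and> z \<le> y. coeff f x z * coeff g z y)"

lemma coeff_times_aux:
  "coeff (f * g) x y = (\<Sum>z | x \<le> z \<and> z \<le> y. coeff f x z * coeff g z y)"
  for f g :: "('a, 'b) incidence_alg"
proof (cases "x \<le> y")
  case False
  then have "{z. x \<le> z \<and> z \<le> y} = {}" by auto
  with False show ?thesis by (simp only: coeff_eq_0 sum.empty not_False_eq_True)
qed (simp add: times_incidence_alg_def coeff_incidence)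

instance
proof
  fix f g h :: "('a, 'b) incidence_alg"
  show "f * g * h = f * (g * h)"
  proof (rule incidence_eqI)
    fix x y :: 'a
    let ?I = "\<lambda>x y. {z. x \<le> z \<and> z \<le> y}"
    have "coeff (f * g * h) x y =
        (\<Sum>z\<in>?I x y. \<Sum>w\<in>{w \<in> ?I x y. w \<le> z}. coeff f x w * coeff g w z * coeff h z y)"
      unfolding coeff_times_aux sum_distrib_right
      by (intro sum.cong refl) auto
    also have "\<dots> = (\<Sum>w\<in>?I x y. \<Sum>z\<in>{z \<in> ?I x y. w \<le> z}. coeff f x w * coeff g w z * coeff h z y)"
      by (rule sum.swap_restrict) (rule finite_interval)+
    also have "\<dots> = coeff (f * (g * h)) x y"
      unfolding coeff_times_aux sum_distrib_left
      by (intro sum.cong refl) (auto simp: mult.assoc)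
    finally show "coeff (f * g * h) x y = coeff (f * (g * h)) x y" .
  qed
  show "1 * f = f"
  proof (rule incidence_eqI)
    fix x y :: 'a
    assume "x \<le> y"
    have "coeff (1 * f) x y = (\<Sum>z | x \<le> z \<and> z \<le> y. if x = z then coeff f z y else 0)"
      unfolding coeff_times_aux
      by (intro sum.cong refl) (auto simp: one_incidence_alg_def coeff_incidence)
    with \<open>x \<le> y\<close> show "coeff (1 * f) x y = coeff f x y"
      by (simp add: sum.delta' sum.delta finite_interval)
  qed
  show "f * 1 = f"
  proof (rule incidence_eqI)
    fix x y :: 'a
    assume "x \<le> y"
    have "coeff (f * 1) x y = (\<Sum>z | x \<le> z \<and> z \<le> y. if z = y then coeff f x z else 0)"
      unfolding coeff_times_aux
      by (intro sum.cong refl) (auto simp: one_incidence_alg_def coeff_incidence)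
    with \<open>x \<le> y\<close> show "coeff (f * 1) x y = coeff f x y"
      by (simp add: sum.delta' sum.delta finite_interval)
  qed
  show "(f + g) * h = f * h + g * h"
    by (rule incidence_eqI) (simp add: coeff_times_aux coeff_plus algebra_simps sum.distrib)
  show "f * (g + h) = f * g + f * h"
    by (rule incidence_eqI) (simp add: coeff_times_aux coeff_plus algebra_simps sum.distrib)
  have "coeff (0 :: ('a, 'b) incidence_alg) x x \<noteq> coeff 1 x x" for x
    by (simp add: coeff_zero one_incidence_alg_def coeff_incidence)
  then show "(0 :: ('a, 'b) incidence_alg) \<noteq> 1" by metis
qed

end

lemma coeff_one: "coeff 1 x y = (if x = y then 1 else 0)"
  by (simp add: one_incidence_alg_def coeff_incidence)

lemma coeff_times:
  "coeff (f * g) x y = (\<Sum>z | x \<le> z \<and> z \<le> y. coeff f x z * coeff g z y)"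
  by (rule coeff_times_aux)

lift_definition scale :: "'k::field \<Rightarrow> ('a::order, 'k) incidence_alg \<Rightarrow> ('a, 'k) incidence_alg"
  is "\<lambda>c f x y. c * f x y" by simp

lemma coeff_scale: "coeff (scale c f) x y = c * coeff f x y"
  by transfer simp

lemma vector_space_scale: "vector_space scale"
  by standard (transfer; simp add: algebra_simps fun_eq_iff)+

lemma scale_mult_left: "scale c f * g = scale c (f * g)"
  by (rule incidence_eqI) (simp add: coeff_times coeff_scale sum_distrib_left mult.assoc)

lemma scale_mult_right: "f * scale c g = scale c (f * g)"
  by (rule incidence_eqI) (simp add: coeff_times coeff_scale sum_distrib_left mult.left_commute)


section \<open>Skew derivations of an associative algebra\<close>

text \<open>The first argument is the scalar multiplication of the algebra.\<close>
definition Der :: "('k::field \<Rightarrow> 'b::ring_1 \<Rightarrow> 'b) \<Rightarrow> ('b \<Rightarrow> 'b) \<Rightarrow> ('b \<Rightarrow> 'b) set" where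
  "Der s \<psi> = {d. Vector_Spaces.linear s s d \<and> (\<forall>a b. d (a * b) = d a * b + \<psi> a * d b)}"

definition inner_der :: "('b::ring_1 \<Rightarrow> 'b) \<Rightarrow> 'b \<Rightarrow> 'b \<Rightarrow> 'b" where
  "inner_der \<psi> a b = a * b - \<psi> b * a"

definition IDer :: "('b::ring_1 \<Rightarrow> 'b) \<Rightarrow> ('b \<Rightarrow> 'b) set" where
  "IDer \<psi> = range (inner_der \<psi>)"


section \<open>Multiplicative automorphisms and automorphisms induced by the poset\<close>

definition order_aut :: "('a::order \<Rightarrow> 'a) \<Rightarrow> bool" where
  "order_aut lam \<longleftrightarrow> bij lam \<and> (\<forall>x y. x \<le> y \<longleftrightarrow> lam x \<le> lam y)"

definition multiplicative :: "('a::order, 'k::field) incidence_alg \<Rightarrow> bool" where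
  "multiplicative \<sigma> \<longleftrightarrow>
     (\<forall>x y. x \<le> y \<longrightarrow> coeff \<sigma> x y \<noteq> 0) \<and>
     (\<forall>x y z. x \<le> y \<and> y \<le> z \<longrightarrow> coeff \<sigma> x z = coeff \<sigma> x y * coeff \<sigma> y z)"

definition mult_aut ::
    "('a::order, 'k::field) incidence_alg \<Rightarrow> ('a, 'k) incidence_alg \<Rightarrow> ('a, 'k) incidence_alg" where
  "mult_aut \<sigma> f = incidence (\<lambda>x y. coeff \<sigma> x y * coeff f x y)"

definition induced_aut ::
    "('a::order \<Rightarrow> 'a) \<Rightarrow> ('a, 'k::field) incidence_alg \<Rightarrow> ('a, 'k) incidence_alg" where
  "induced_aut lam f = incidence (\<lambda>x y. coeff f (inv lam x) (inv lam y))"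

definition psi ::
    "('a::order, 'k::field) incidence_alg \<Rightarrow> ('a \<Rightarrow> 'a) \<Rightarrow>
     ('a, 'k) incidence_alg \<Rightarrow> ('a, 'k) incidence_alg" where
  "psi \<sigma> lam = mult_aut \<sigma> \<circ> induced_aut lam"

lemma order_aut_le_iff: "order_aut lam \<Longrightarrow> lam x \<le> lam y \<longleftrightarrow> x \<le> y"
  by (simp add: order_aut_def)

lemma order_aut_inv:
  assumes "order_aut lam"
  shows "inv lam (lam x) = x" "lam (inv lam x) = x"
  using assms by (auto simp: order_aut_def bij_is_inj bij_is_surj surj_f_inv_f)

lemma order_aut_inv_le_iff: "order_aut lam \<Longrightarrow> inv lam x \<le> inv lam y \<longleftrightarrow> x \<le> y"
  using order_aut_le_iff[of lam "inv lam x" "inv lam y"] by (simp add: order_aut_inv)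

text \<open>The truncation in \<^const>\<open>incidence\<close> is vacuous in both maps.\<close>

lemma coeff_mult_aut: "coeff (mult_aut \<sigma> f) x y = coeff \<sigma> x y * coeff f x y"
  by (simp add: mult_aut_def coeff_incidence coeff_eq_0)

lemma coeff_induced_aut:
  "order_aut lam \<Longrightarrow> coeff (induced_aut lam f) x y = coeff f (inv lam x) (inv lam y)"
  by (simp add: induced_aut_def coeff_incidence coeff_eq_0 order_aut_inv_le_iff)


section \<open>Additive and potential skew derivations\<close>

definition skew_additive ::
    "('a::order, 'k::field) incidence_alg \<Rightarrow> ('a \<Rightarrow> 'a) \<Rightarrow> ('a, 'k) incidence_alg \<Rightarrow> bool" where
  "skew_additive \<sigma> lam \<tau> \<longleftrightarrow>
     (\<forall>x y. \<not> lam x \<le> y \<longrightarrow> coeff \<tau> x y = 0) \<and>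
     (\<forall>x y z. x \<le> y \<and> y \<le> z \<longrightarrow>
        coeff \<tau> x z = coeff \<tau> x y + coeff \<sigma> (lam x) (lam y) * coeff \<tau> y z)"

text \<open>
  The defining equation \<open>L\<^sub>\<tau>(f)(\<lambda>(x), y) = \<tau>(x, y) f(x, y)\<close> is solved for the first argument;
  \<open>coeff_L_map\<close> recovers it for additive \<open>\<tau>\<close>.
\<close>
definition L_map ::
    "('a::order \<Rightarrow> 'a) \<Rightarrow> ('a, 'k::field) incidence_alg \<Rightarrow>
     ('a, 'k) incidence_alg \<Rightarrow> ('a, 'k) incidence_alg" where
  "L_map lam \<tau> f = incidence (\<lambda>u y. coeff \<tau> (inv lam u) y * coeff f (inv lam u) y)"

lemma coeff_L_map:
  assumes "order_aut lam" "skew_additive \<sigma> lam \<tau>"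
  shows "coeff (L_map lam \<tau> f) (lam x) y = coeff \<tau> x y * coeff f x y"
  using assms by (auto simp: L_map_def coeff_incidence order_aut_inv skew_additive_def)

lemma L_map_in_Der:
  fixes \<sigma> \<tau> :: "('a::locally_finite_order, 'k::field) incidence_alg"
  assumes aut: "order_aut lam" and add: "skew_additive \<sigma> lam \<tau>"
  shows "L_map lam \<tau> \<in> Der scale (psi \<sigma> lam)"
proof -
  note L = coeff_L_map[OF aut add]
  have eqI: "f = g" if "\<And>x y. coeff f (lam x) y = coeff g (lam x) y"
    for f g :: "('a, 'k) incidence_alg"
    by (rule incidence_eqI) (metis that order_aut_inv(2)[OF aut])
  have t0: "coeff \<tau> x y = 0" if "\<not> lam x \<le> y" for x y
    using add that by (simp add: skew_additive_def)
  have le_inv: "x \<le> inv lam y \<longleftrightarrow> lam x \<le> y" for x y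
    by (metis order_aut_inv(2)[OF aut] order_aut_le_iff[OF aut])
  have lin: "Vector_Spaces.linear scale scale (L_map lam \<tau>)"
  proof (rule Vector_Spaces.linear.intro)
    show "module_hom scale scale (L_map lam \<tau>)"
    proof (intro module_hom.intro module_hom_axioms.intro)
      show "module (scale :: 'k \<Rightarrow> ('a, 'k) incidence_alg \<Rightarrow> _)"
        using vector_space_scale by (simp add: vector_space_def module_def)
      show "L_map lam \<tau> (f + g) = L_map lam \<tau> f + L_map lam \<tau> g" for f g
        by (rule eqI) (simp add: L coeff_plus algebra_simps)
      show "L_map lam \<tau> (scale c f) = scale c (L_map lam \<tau> f)" for c f
        by (rule eqI) (simp add: L coeff_scale)
    qed (use vector_space_scale in \<open>simp add: vector_space_def module_def\<close>)
  qed (rule vector_space_scale)+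
  have "L_map lam \<tau> (f * g) = L_map lam \<tau> f * g + psi \<sigma> lam f * L_map lam \<tau> g" for f g
  proof (rule eqI)
    fix x y :: 'a
    let ?I = "{z. x \<le> z \<and> z \<le> y}"
    have fin: "finite ?I" by (rule finite_interval)
    have A: "coeff (L_map lam \<tau> f * g) (lam x) y =
        (\<Sum>z\<in>?I. coeff \<tau> x z * coeff f x z * coeff g z y)"
      unfolding coeff_times L
      by (rule sum.mono_neutral_cong[OF fin finite_interval])
        (auto simp: coeff_eq_0 t0)
    have "coeff (psi \<sigma> lam f * L_map lam \<tau> g) (lam x) y =
        (\<Sum>w | lam x \<le> w \<and> w \<le> y. coeff (psi \<sigma> lam f) (lam x) w * coeff (L_map lam \<tau> g) w y)"
      by (rule coeff_times)
    also have "\<dots> = (\<Sum>z | x \<le> z \<and> lam z \<le> y.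
        coeff (psi \<sigma> lam f) (lam x) (lam z) * coeff (L_map lam \<tau> g) (lam z) y)"
      by (rule sum.reindex_bij_witness[where i = lam and j = "inv lam"])
        (auto simp: order_aut_inv[OF aut] le_inv order_aut_le_iff[OF aut])
    also have "\<dots> = (\<Sum>z | x \<le> z \<and> lam z \<le> y.
        coeff \<sigma> (lam x) (lam z) * coeff f x z * (coeff \<tau> z y * coeff g z y))"
      by (simp add: psi_def coeff_mult_aut coeff_induced_aut[OF aut] order_aut_inv[OF aut] L)
    also have "\<dots> = (\<Sum>z\<in>?I. coeff \<sigma> (lam x) (lam z) * coeff f x z * (coeff \<tau> z y * coeff g z y))"
    proof (rule sum.mono_neutral_cong[OF fin])
      have "{z. x \<le> z \<and> lam z \<le> y} \<subseteq> inv lam ` {w. lam x \<le> w \<and> w \<le> y}"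
        by (force simp: order_aut_inv[OF aut] order_aut_le_iff[OF aut] image_iff intro: exI[of _ "lam _"])
      then show "finite {z. x \<le> z \<and> lam z \<le> y}"
        by (rule finite_subset) (intro finite_imageI finite_interval)
    qed (auto simp: coeff_eq_0 t0)
    finally have B: "coeff (psi \<sigma> lam f * L_map lam \<tau> g) (lam x) y = \<dots>" .
    have "coeff (L_map lam \<tau> (f * g)) (lam x) y =
        (\<Sum>z\<in>?I. coeff \<tau> x y * (coeff f x z * coeff g z y))"
      by (simp add: L coeff_times sum_distrib_left)
    also have "\<dots> = (\<Sum>z\<in>?I. coeff \<tau> x z * coeff f x z * coeff g z y +
        coeff \<sigma> (lam x) (lam z) * coeff f x z * (coeff \<tau> z y * coeff g z y))"
    proof (rule sum.cong[OF refl])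
      fix z assume "z \<in> ?I"
      with add have "coeff \<tau> x y = coeff \<tau> x z + coeff \<sigma> (lam x) (lam z) * coeff \<tau> z y"
        by (simp add: skew_additive_def)
      then show "coeff \<tau> x y * (coeff f x z * coeff g z y) =
          coeff \<tau> x z * coeff f x z * coeff g z y +
          coeff \<sigma> (lam x) (lam z) * coeff f x z * (coeff \<tau> z y * coeff g z y)"
        by (simp add: algebra_simps)
    qed
    finally show "coeff (L_map lam \<tau> (f * g)) (lam x) y =
        coeff (L_map lam \<tau> f * g + psi \<sigma> lam f * L_map lam \<tau> g) (lam x) y"
      by (simp add: A B coeff_plus sum.distrib)
  qed
  with lin show ?thesis by (simp add: Der_def)
qed

definition ADer ::
    "('a::locally_finite_order, 'k::field) incidence_alg \<Rightarrow> ('a \<Rightarrow> 'a) \<Rightarrow>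
     (('a, 'k) incidence_alg \<Rightarrow> ('a, 'k) incidence_alg) set" where
  "ADer \<sigma> lam = {d \<in> Der scale (psi \<sigma> lam). \<exists>\<tau>. skew_additive \<sigma> lam \<tau> \<and> d = L_map lam \<tau>}"

definition tau_of ::
    "('a::order, 'k::field) incidence_alg \<Rightarrow> ('a \<Rightarrow> 'a) \<Rightarrow> ('a \<Rightarrow> 'k) \<Rightarrow> ('a, 'k) incidence_alg" where
  "tau_of \<sigma> lam \<epsilon> = incidence (\<lambda>x y. \<epsilon> x - coeff \<sigma> (lam x) (lam y) * \<epsilon> y)"

definition skew_potential ::
    "('a::order, 'k::field) incidence_alg \<Rightarrow> ('a \<Rightarrow> 'a) \<Rightarrow> ('a, 'k) incidence_alg \<Rightarrow> bool" where
  "skew_potential \<sigma> lam \<tau> \<longleftrightarrow>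
     (\<exists>\<epsilon>. (\<forall>x. \<not> lam x \<le> x \<longrightarrow> \<epsilon> x = 0) \<and> \<tau> = tau_of \<sigma> lam \<epsilon>)"

lemma potential_imp_additive:
  assumes mult: "multiplicative \<sigma>" and aut: "order_aut lam" and "skew_potential \<sigma> lam \<tau>"
  shows "skew_additive \<sigma> lam \<tau>"
proof -
  from assms(3) obtain \<epsilon> where e: "\<And>x. \<not> lam x \<le> x \<Longrightarrow> \<epsilon> x = 0" and t: "\<tau> = tau_of \<sigma> lam \<epsilon>"
    by (auto simp: skew_potential_def)
  have "coeff \<tau> x y = 0" if "\<not> lam x \<le> y" for x y
  proof (cases "x \<le> y")
    case True
    then have "\<not> lam x \<le> x" "\<not> lam y \<le> y"
      using that aut order_aut_le_iff[OF aut, of x y] by (auto dest: order_trans)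
    then show ?thesis by (simp add: t tau_of_def coeff_incidence e)
  qed (simp add: coeff_eq_0)
  moreover have "coeff \<tau> x z = coeff \<tau> x y + coeff \<sigma> (lam x) (lam y) * coeff \<tau> y z"
    if "x \<le> y" "y \<le> z" for x y z
  proof -
    have "coeff \<sigma> (lam x) (lam z) = coeff \<sigma> (lam x) (lam y) * coeff \<sigma> (lam y) (lam z)"
      using mult that aut by (simp add: multiplicative_def order_aut_le_iff)
    with that order_trans[OF that] show ?thesis
      by (simp add: t tau_of_def coeff_incidence algebra_simps)
  qed
  ultimately show ?thesis by (auto simp: skew_additive_def)
qed

definition PDer ::
    "('a::locally_finite_order, 'k::field) incidence_alg \<Rightarrow> ('a \<Rightarrow> 'a) \<Rightarrow>
     (('a, 'k) incidence_alg \<Rightarrow> ('a, 'k) incidence_alg) set" where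
  "PDer \<sigma> lam = {d \<in> ADer \<sigma> lam. \<exists>\<tau>. skew_potential \<sigma> lam \<tau> \<and> d = L_map lam \<tau>}"

lemma PDer_eq:
  "multiplicative \<sigma> \<Longrightarrow> order_aut lam \<Longrightarrow> PDer \<sigma> lam = L_map lam ` {\<tau>. skew_potential \<sigma> lam \<tau>}"
  by (auto simp: PDer_def ADer_def intro: L_map_in_Der potential_imp_additive)

end

theory Submission
  imports Defs
begin

text \<open>
  Both inclusions rest on one computation. Put \<open>\<epsilon>(x) = a(\<lambda>(x), x)\<close>, the values of \<open>a\<close>
  on the skew diagonal of all pairs \<open>(\<lambda>(x), x)\<close>. The entry of \<open>a f - \<psi>(f) a\<close> at \<open>(\<lambda>(x), y)\<close> contains the terms
  \<open>a(\<lambda>(x), x) f(x, y)\<close> and \<open>\<sigma>(\<lambda>(x), \<lambda>(y)) f(x, y) a(\<lambda>(y), y)\<close>, whose difference is exactly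
  \<open>\<tau>\<^sub>\<epsilon>(x, y) f(x, y)\<close>, the entry of the potential derivation belonging to \<open>\<epsilon>\<close>. The remaining
  terms of the two products disappear in two situations (\<open>coeff_inner_der_psi\<close>).

  If \<open>a\<close> is concentrated on the skew diagonal, they vanish for every \<open>f\<close>. Spreading a given
  \<open>\<epsilon>\<close> along the skew diagonal therefore makes every potential derivation inner.

  If \<open>f\<close> is the matrix unit \<open>e\<^sub>x\<^sub>y\<close>, they vanish for every \<open>a\<close>. Since \<open>L\<^sub>\<tau>(e\<^sub>x\<^sub>y)\<close> has the entry
  \<open>\<tau>(x, y)\<close> at \<open>(\<lambda>(x), y)\<close>, an equality \<open>L\<^sub>\<tau> = D\<^sub>a\<close> can be tested on all matrix units, and it
  forces \<open>\<tau> = \<tau>\<^sub>\<epsilon>\<close>.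
\<close>

lemma coeff_times_single:
  fixes f g :: "('a::locally_finite_order, 'k::ring_1) incidence_alg"
  assumes "\<And>z. z \<noteq> w \<Longrightarrow> coeff f x z * coeff g z y = 0"
  shows "coeff (f * g) x y = coeff f x w * coeff g w y"
proof -
  have "coeff (f * g) x y =
      (\<Sum>z | x \<le> z \<and> z \<le> y. if z = w then coeff f x w * coeff g w y else 0)"
    unfolding coeff_times using assms by (intro sum.cong) auto
  also have "\<dots> = coeff f x w * coeff g w y"
    by (auto simp: sum.delta finite_interval coeff_eq_0)
  finally show ?thesis .
qed

lemma coeff_psi:
  assumes "order_aut lam"
  shows "coeff (psi \<sigma> lam f) (lam x) (lam y) = coeff \<sigma> (lam x) (lam y) * coeff f x y"
  using assms by (simp add: psi_def coeff_mult_aut coeff_induced_aut order_aut_inv)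

text \<open>
  The hypotheses leave the term \<open>z = x\<close> of \<open>a f\<close> and the term \<open>\<lambda>(z) = \<lambda>(y)\<close> of \<open>\<psi>(f) a\<close>.
  As they only ask products to vanish, it does not matter whether \<open>a\<close> or \<open>f\<close> is the sparse factor.
\<close>
lemma coeff_inner_der_psi:
  fixes \<sigma> a f :: "('a::locally_finite_order, 'k::field) incidence_alg"
  assumes aut: "order_aut lam"
    and left: "\<And>z. z \<noteq> x \<Longrightarrow> coeff a (lam x) z * coeff f z y = 0"
    and right: "\<And>z. z \<noteq> y \<Longrightarrow> coeff f x z * coeff a (lam z) y = 0"
  shows "coeff (inner_der (psi \<sigma> lam) a f) (lam x) y =
    (coeff a (lam x) x - coeff \<sigma> (lam x) (lam y) * coeff a (lam y) y) * coeff f x y"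
proof -
  have "coeff (psi \<sigma> lam f * a) (lam x) y = coeff (psi \<sigma> lam f) (lam x) (lam y) * coeff a (lam y) y"
  proof (rule coeff_times_single)
    fix w assume "w \<noteq> lam y"
    moreover have w: "w = lam (inv lam w)"
      by (simp add: order_aut_inv(2)[OF aut])
    ultimately have "coeff f x (inv lam w) * coeff a (lam (inv lam w)) y = 0"
      using right by metis
    then show "coeff (psi \<sigma> lam f) (lam x) w * coeff a w y = 0"
      by (subst (1 2) w) (auto simp: coeff_psi[OF aut])
  qed
  moreover have "coeff (a * f) (lam x) y = coeff a (lam x) x * coeff f x y"
    by (rule coeff_times_single) (rule left)
  ultimately show ?thesis
    by (simp add: inner_der_def coeff_minus coeff_psi[OF aut] algebra_simps)
qed

lemma L_map_tau_of_eq_inner_der: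
  fixes \<sigma> :: "('a::locally_finite_order, 'k::field) incidence_alg"
  assumes mult: "multiplicative \<sigma>" and aut: "order_aut lam"
    and supp: "\<And>x. \<not> lam x \<le> x \<Longrightarrow> \<epsilon> x = 0"
  shows "L_map lam (tau_of \<sigma> lam \<epsilon>) =
    inner_der (psi \<sigma> lam) (incidence (\<lambda>u y. if u = lam y then \<epsilon> y else 0))"
    (is "_ = inner_der _ ?a")
proof (intro ext incidence_eqI)
  fix f :: "('a, 'k) incidence_alg" and u y :: 'a
  have a: "coeff ?a (lam x) z = (if x = z then \<epsilon> x else 0)" for x z
    using supp order_aut_inv(1)[OF aut] by (auto simp: coeff_incidence dest: arg_cong[of _ _ "inv lam"])
  have tau: "coeff (tau_of \<sigma> lam \<epsilon>) x y =
      (if x \<le> y then \<epsilon> x - coeff \<sigma> (lam x) (lam y) * \<epsilon> y else 0)" for x y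
    by (simp add: tau_of_def coeff_incidence)
  have add: "skew_additive \<sigma> lam (tau_of \<sigma> lam \<epsilon>)"
    using supp by (intro potential_imp_additive[OF mult aut]) (auto simp: skew_potential_def)
  have "coeff (L_map lam (tau_of \<sigma> lam \<epsilon>) f) (lam x) y =
      coeff (inner_der (psi \<sigma> lam) ?a f) (lam x) y" for x
    unfolding coeff_L_map[OF aut add]
    by (subst coeff_inner_der_psi[OF aut]) (auto simp: a tau coeff_eq_0)
  from this[of "inv lam u"]
  show "coeff (L_map lam (tau_of \<sigma> lam \<epsilon>) f) u y = coeff (inner_der (psi \<sigma> lam) ?a f) u y"
    by (simp add: order_aut_inv(2)[OF aut])
qed

lemma skew_potential_if_L_map_inner:
  fixes \<sigma> \<tau> a :: "('a::locally_finite_order, 'k::field) incidence_alg"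
  assumes aut: "order_aut lam" and add: "skew_additive \<sigma> lam \<tau>"
    and eq: "L_map lam \<tau> = inner_der (psi \<sigma> lam) a"
  shows "skew_potential \<sigma> lam \<tau>"
  unfolding skew_potential_def
proof (intro exI conjI allI impI)
  show "coeff a (lam x) x = 0" if "\<not> lam x \<le> x" for x
    using that by (rule coeff_eq_0)
  show "\<tau> = tau_of \<sigma> lam (\<lambda>x. coeff a (lam x) x)"
  proof (rule incidence_eqI)
    fix x y :: 'a
    assume le: "x \<le> y"
    \<comment> \<open>the matrix unit \<open>e\<^sub>x\<^sub>y\<close>\<close>
    define e :: "('a, 'k) incidence_alg"
      where "e = incidence (\<lambda>u v. if u = x \<and> v = y then 1 else 0)"
    have e: "coeff e u v = (if u = x \<and> v = y then 1 else 0)" for u v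
      using le by (simp add: e_def coeff_incidence)
    have "coeff \<tau> x y = coeff (L_map lam \<tau> e) (lam x) y"
      by (simp add: coeff_L_map[OF aut add] e)
    also have "\<dots> = coeff a (lam x) x - coeff \<sigma> (lam x) (lam y) * coeff a (lam y) y"
      unfolding eq by (subst coeff_inner_der_psi[OF aut]) (auto simp: e)
    finally show "coeff \<tau> x y = coeff (tau_of \<sigma> lam (\<lambda>x. coeff a (lam x) x)) x y"
      using le by (simp add: tau_of_def coeff_incidence)
  qed
qed

theorem theorem2p14:
  fixes \<sigma> :: "('a::locally_finite_order, 'k::field) incidence_alg"
    and lam :: "'a \<Rightarrow> 'a"
  assumes "multiplicative \<sigma>" and "order_aut lam"
  shows "PDer \<sigma> lam = IDer (psi \<sigma> lam) \<inter> ADer \<sigma> lam"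
proof (intro equalityI subsetI)
  fix d assume d: "d \<in> PDer \<sigma> lam"
  then have "d \<in> IDer (psi \<sigma> lam)"
    using L_map_tau_of_eq_inner_der[OF assms]
    by (auto simp: PDer_def skew_potential_def IDer_def)
  with d show "d \<in> IDer (psi \<sigma> lam) \<inter> ADer \<sigma> lam"
    by (simp add: PDer_def)
next
  fix d assume "d \<in> IDer (psi \<sigma> lam) \<inter> ADer \<sigma> lam"
  then obtain \<tau> a where ADer: "d \<in> ADer \<sigma> lam" and add: "skew_additive \<sigma> lam \<tau>"
    and d: "d = L_map lam \<tau>" and inner: "d = inner_der (psi \<sigma> lam) a"
    unfolding ADer_def IDer_def by blast
  have "skew_potential \<sigma> lam \<tau>"
    by (rule skew_potential_if_L_map_inner[OF assms(2) add trans[OF d[symmetric] inner]])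
  then show "d \<in> PDer \<sigma> lam"
    unfolding PDer_def mem_Collect_eq by (intro conjI exI[of _ \<tau>] ADer d)
qed

end
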